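(* Consider the distribution model. Consider any offline dataset $D\sim\mathcal D^N$, where $d(a^* )\ge\frac1{C^*}$ for some $C^*\in(1,2)$, and any unlearning request $U$ with $|U|=k$ consisting of data points of arm $a_0$. When $k\le\min\left\{\frac{3N}{4},\frac{(2-C^* )N}{C^*}\right\}$, the arm $\hat a'$ returned by the count-based unlearning algorithm (described in the context), paired with the imitation learning rule, has worst-case expected sub-optimality $\mathbb E[\mu(a^* )-\mu(\hat a')]$, and hence gives $SubOpt(N,C^*,k,\varepsilon,0)$, bounded by $$SubOpt(N,C^*,k,\varepsilon,0)=O\left(e^{-\frac{N-k}{2}\ln\frac{C^*}{8(C^*-1)}+\frac{N+k}{2}\ln\frac{2}{C^*}}\right),$$ where $O(\cdot)$ hides an absolute constant.
   Context: Offline stochastic multi-armed bandit: $\mathcal A=[m]$ is the set of arms; pulling arm $a$ gives a reward in $[0,1]$ drawn from a fixed unknown distribution $R(a)$ with mean $\mu(a)$; $a^*=\arg\max_a\mu(a)$. Distribution model: $D=\{(a_i,r_i)\}_{i=1}^N$ with $(a_i,r_i)$ i.i.d. from $\mathcal D=d\otimes R$, i.e. $a_i\sim d$ for a behavior policy $d\in\Delta(\mathcal A)$ and then $r_i\sim R(a_i)$; $N(a)$ is the number of samples of arm $a$ in $D$. Imitation learning rule: $\pi(D)$ is the arm with the largest count $N(a)$ in $D$. Count-based unlearning algorithm: given the counts of $D$ and a request $U$ of $k$ points of arm $a_0$, set $N'(a_0)=N(a_0)-k$, $N'(a)=N(a)$ for $a\ne a_0$, and output $\hat a'=\arg\max_aN'(a)$.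 On the empty request it outputs the learned arm $\pi(D\setminus U)$. The pair (unlearning algorithm $\pi'$, learning algorithm $\pi$) is $(\varepsilon,\delta)$-unlearning (UL) if for all $D$, all $U\subseteq D$ and all $A\subseteq\mathcal A$: $\Pr[\pi'(U,\pi(D),T(D))\in A]\le e^\varepsilon\Pr[\pi'(\emptyset,\pi(D\setminus U),T(D\setminus U))\in A]+\delta$ and the same with the two probabilities interchanged, where $T$ is a stored statistic. Requests $U$ are selected independently of the rewards of the data points. Define $$SubOpt(N,C^*,k,\varepsilon,\delta)=\inf_{(\pi',\pi)\ (\varepsilon,\delta)\text{-UL}}\ \sup_{D\sim\mathcal D^N,\,U\subseteq D}\mathbb E[\mu(a^* )-\mu(\hat a')],$$ with $|U|=k$ and $U$ from a single arm, the supremum being over $\mathcal D=d\otimes R$ with $d(a^* )\ge1/C^*$ and over requests, and the expectation over the generation of $D$ and the randomness of $\pi,\pi'$. *)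

theory Defs
  imports "HOL-Probability.Probability"
begin

text \<open>Arms are the naturals in \<open>{1..m}\<close>; a data point is a pair (arm, reward).\<close>

type_synonym dataset = "(nat \<times> real) multiset"
type_synonym learner = "dataset \<Rightarrow> nat pmf"
type_synonym statistic = "nat \<Rightarrow> nat"
type_synonym unlearner = "dataset \<Rightarrow> nat \<Rightarrow> statistic \<Rightarrow> nat pmf"

text \<open>
  The paper lets the stored statistic take values in an arbitrary set. HOL cannot quantify over
  types, but the type \<^typ>\<open>nat \<Rightarrow> nat\<close> loses nothing: the following lemma injects all datasets into it,
  and any function of a dataset factors through a choice of representative datasets.
\<close>

lemma ex_inj_dataset_statistic: "\<exists>f :: dataset \<Rightarrow> statistic. inj f"
proof -
  define F :: "dataset \<Rightarrow> nat \<times> rat \<Rightarrow> nat"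
    where "F D = (\<lambda>(a, q). size {#p \<in># D. fst p = a \<and> snd p < of_rat q#})" for D
  have "inj F"
  proof (rule injI, rule multiset_eqI)
    fix D E :: dataset and p :: "nat \<times> real"
    assume eq: "F D = F E"
    obtain a r where p: "p = (a, r)" by (cases p)
    define X where "X = snd ` (set_mset D \<union> set_mset E)"
    have fin: "finite X" by (simp add: X_def)
    define l where "l = Max (insert (r - 1) {x \<in> X. x < r})"
    define u where "u = Min (insert (r + 1) {x \<in> X. x > r})"
    have l: "l < r" "\<And>x. x \<in> X \<Longrightarrow> x < r \<Longrightarrow> x \<le> l"
      using fin by (auto simp: l_def)
    have u: "r < u" "\<And>x. x \<in> X \<Longrightarrow> x > r \<Longrightarrow> u \<le> x"
      using fin by (auto simp: u_def)
    obtain q where q: "l < of_rat q" "of_rat q < r"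
      using of_rat_dense[OF l(1)] by blast
    obtain s where s: "r < of_rat s" "of_rat s < u"
      using of_rat_dense[OF u(1)] by blast
    have key: "F G (a, s) = F G (a, q) + count G (a, r)"
      if G: "G = D \<or> G = E" for G
    proof -
      have X: "snd y \<in> X" if "y \<in># G" for y using that G by (auto simp: X_def)
      have iff: "fst y = a \<and> snd y < of_rat s \<longleftrightarrow> (fst y = a \<and> snd y < of_rat q) \<or> y = (a, r)"
        if "y \<in># G" for y
        using l(2)[OF X[OF that]] u(2)[OF X[OF that]] q s
        by (cases "snd y" r rule: linorder_cases) (auto simp: prod_eq_iff)
      have "{#y \<in># G. fst y = a \<and> snd y < of_rat s#} =
            {#y \<in># G. fst y = a \<and> snd y < of_rat q#} + {#y \<in># G. y = (a, r)#}"
      proof (rule multiset_eqI)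
        fix y
        show "count {#y \<in># G. fst y = a \<and> snd y < of_rat s#} y =
              count ({#y \<in># G. fst y = a \<and> snd y < of_rat q#} + {#y \<in># G. y = (a, r)#}) y"
        proof (cases "y \<in># G")
          case True
          then show ?thesis using iff[OF True] q by (auto split: if_splits)
        next
          case False
          then show ?thesis by (auto simp: not_in_iff)
        qed
      qed
      moreover have "{#y \<in># G. y = (a, r)#} = replicate_mset (count G (a, r)) (a, r)"
        by (auto simp: multiset_eq_iff)
      ultimately show ?thesis by (simp add: F_def)
    qed
    show "count D p = count E p"
      using key[of D] key[of E] eq by (simp add: p)
  qed
  then have "inj (\<lambda>D n. F D (from_nat n))"
    by (auto simp: inj_def fun_eq_iff) (metis from_nat_to_nat)
  then show ?thesis by blast
qed

definition arm_counts :: "dataset \<Rightarrow> nat \<Rightarrow> nat"  \<comment> \<open>\<open>N(a)\<close>\<close>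
  where "arm_counts D a = size {#p \<in># D. fst p = a#}"

text \<open>Ties are broken by the unspecified choice made by \<^const>\<open>arg_max_on\<close>.\<close>

definition imitation_learner :: "nat \<Rightarrow> learner"
  where "imitation_learner m D = return_pmf (arg_max_on (arm_counts D) {1..m})"

text \<open>
  Used with the stored statistic \<^const>\<open>arm_counts\<close>. For a request \<open>U\<close> of \<open>k\<close> points of arm \<open>a\<^sub>0\<close>
  the argument of \<^const>\<open>arg_max_on\<close> is \<open>N(a\<^sub>0) - k\<close> at \<open>a\<^sub>0\<close> and \<open>N(a)\<close> at every other arm.
  Requests spanning several arms must be handled too, as the unlearning guarantee covers
  every \<open>U \<subseteq> D\<close>.
\<close>

definition count_unlearner :: "nat \<Rightarrow> unlearner"
  where "count_unlearner m U a t =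
    return_pmf (if U = {#} then a else arg_max_on (\<lambda>b. t b - arm_counts U b) {1..m})"

definition unlearn_output ::
  "unlearner \<Rightarrow> learner \<Rightarrow> (dataset \<Rightarrow> statistic) \<Rightarrow> dataset \<Rightarrow> dataset \<Rightarrow> nat pmf"
  where "unlearn_output P L T U D = bind_pmf (L D) (\<lambda>a. P U a (T D))"

definition is_unlearning ::
  "nat \<Rightarrow> real \<Rightarrow> real \<Rightarrow> unlearner \<Rightarrow> learner \<Rightarrow> (dataset \<Rightarrow> statistic) \<Rightarrow> bool"
  where "is_unlearning m \<epsilon> \<delta> P L T \<longleftrightarrow>
    (\<forall>D U A. set_mset D \<subseteq> {1..m} \<times> {0..1} \<longrightarrow> U \<subseteq># D \<longrightarrow> A \<subseteq> {1..m} \<longrightarrow>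
      measure_pmf.prob (unlearn_output P L T U D) A
        \<le> exp \<epsilon> * measure_pmf.prob (unlearn_output P L T {#} (D - U)) A + \<delta> \<and>
      measure_pmf.prob (unlearn_output P L T {#} (D - U)) A
        \<le> exp \<epsilon> * measure_pmf.prob (unlearn_output P L T U D) A + \<delta>)"

definition sample_points :: "(nat \<Rightarrow> nat \<times> real) \<Rightarrow> nat set \<Rightarrow> dataset"
  where "sample_points \<omega> I = image_mset \<omega> (mset_set I)"

text \<open>
  The measurability clause makes the expected sub-optimality meaningful: the output probabilities
  are Borel functions of the sample when the set of indices to be unlearned is fixed.
\<close>

definition arm_algorithm ::
  "nat \<Rightarrow> unlearner \<Rightarrow> learner \<Rightarrow> (dataset \<Rightarrow> statistic) \<Rightarrow> bool"
  where "arm_algorithm m P L T \<longleftrightarrow>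
    (\<forall>D. set_pmf (L D) \<subseteq> {1..m}) \<and>
    (\<forall>U a t. a \<in> {1..m} \<longrightarrow> set_pmf (P U a t) \<subseteq> {1..m}) \<and>
    (\<forall>N I a. I \<subseteq> {1..N} \<longrightarrow>
      (\<lambda>\<omega>. pmf (unlearn_output P L T (sample_points \<omega> I) (sample_points \<omega> {1..N})) a)
        \<in> borel_measurable (\<Pi>\<^sub>M i\<in>{1..N}. count_space UNIV \<Otimes>\<^sub>M borel))"

definition arm_mean :: "(nat \<Rightarrow> real measure) \<Rightarrow> nat \<Rightarrow> real"  \<comment> \<open>\<open>\<mu>(a)\<close>\<close>
  where "arm_mean R a = (\<integral>r. r \<partial>R a)"

definition point_dist :: "nat pmf \<Rightarrow> (nat \<Rightarrow> real measure) \<Rightarrow> (nat \<times> real) measure"  \<comment> \<open>\<open>d \<otimes> R\<close>\<close>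
  where "point_dist d R =
    measure_pmf d \<bind> (\<lambda>a. distr (R a) (count_space UNIV \<Otimes>\<^sub>M borel) (Pair a))"

text \<open>
  \<open>a\<close> plays the role of \<open>a\<^sup>*\<close>. Arms outside \<open>{1..m}\<close> are never drawn; they carry a reward
  distribution only because \<open>R\<close> is total.
\<close>

definition bandit_instance ::
  "nat \<Rightarrow> real \<Rightarrow> nat pmf \<Rightarrow> (nat \<Rightarrow> real measure) \<Rightarrow> nat \<Rightarrow> bool"
  where "bandit_instance m C d R a \<longleftrightarrow>
    set_pmf d \<subseteq> {1..m} \<and>
    (\<forall>b. prob_space (R b) \<and> sets (R b) = sets borel \<and> (AE r in R b. r \<in> {0..1})) \<and>
    a \<in> {1..m} \<and> (\<forall>b\<in>{1..m}. arm_mean R b \<le> arm_mean R a) \<and>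
    pmf d a \<ge> 1 / C"

text \<open>
  A request rule selects the indices of the points to unlearn from the sequence of pulled arms
  alone, which expresses that requests are independent of the rewards. It targets an arm \<open>a\<^sub>0\<close>,
  possibly depending on that sequence, and removes exactly \<open>k\<close> of its points; if the sample has
  fewer than \<open>k\<close> points of \<open>a\<^sub>0\<close>, no such request exists and none is made.
\<close>

definition request_rule :: "nat \<Rightarrow> nat \<Rightarrow> nat \<Rightarrow> ((nat \<Rightarrow> nat) \<Rightarrow> nat set) \<Rightarrow> bool"
  where "request_rule m N k req \<longleftrightarrow>
    (\<forall>as. \<exists>a\<^sub>0\<in>{1..m}.
      if k \<le> card {i \<in> {1..N}. as i = a\<^sub>0}
      then req as \<subseteq> {i \<in> {1..N}. as i = a\<^sub>0} \<and> card (req as) = k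
      else req as = {})"

definition expected_subopt ::
  "nat \<Rightarrow> unlearner \<Rightarrow> learner \<Rightarrow> (dataset \<Rightarrow> statistic) \<Rightarrow>
   nat pmf \<Rightarrow> (nat \<Rightarrow> real measure) \<Rightarrow> nat \<Rightarrow> ((nat \<Rightarrow> nat) \<Rightarrow> nat set) \<Rightarrow> real"
  where "expected_subopt N P L T d R a req =
    (\<integral>\<omega>. measure_pmf.expectation
        (unlearn_output P L T
          (sample_points \<omega> (req (\<lambda>i\<in>{1..N}. fst (\<omega> i))))
          (sample_points \<omega> {1..N}))
        (\<lambda>b. arm_mean R a - arm_mean R b)
      \<partial>(\<Pi>\<^sub>M i\<in>{1..N}. point_dist d R))"

definition worst_subopt ::
  "nat \<Rightarrow> nat \<Rightarrow> real \<Rightarrow> nat \<Rightarrow> unlearner \<Rightarrow> learner \<Rightarrow> (dataset \<Rightarrow> statistic) \<Rightarrow> ereal"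
  where "worst_subopt m N C k P L T =
    (SUP (d, R, a, req) \<in>
        {(d, R, a, req). bandit_instance m C d R a \<and> request_rule m N k req}.
      ereal (expected_subopt N P L T d R a req))"

definition SubOpt :: "nat \<Rightarrow> nat \<Rightarrow> real \<Rightarrow> nat \<Rightarrow> real \<Rightarrow> real \<Rightarrow> ereal"
  where "SubOpt m N C k \<epsilon> \<delta> =
    (INF (P, L, T) \<in> {(P, L, T). arm_algorithm m P L T \<and> is_unlearning m \<epsilon> \<delta> P L T}.
      worst_subopt m N C k P L T)"

end

theory Submission
  imports Defs
begin

text \<open>
  Let \<open>Y\<close> be the number of sampled points that do not belong to the best arm. A request removes at
  most \<open>k\<close> points, so afterwards the best arm keeps at least \<open>N - Y - k\<close> points while every other
  arm has at most \<open>Y\<close>: the output can only be suboptimal if \<open>2 Y + k \<ge> N\<close>. Since the requirement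
  on \<open>d\<close> bounds the success probability of the binomial variable \<open>Y\<close> by \<open>(C - 1) / C\<close>,
  the Chernoff bound for the event \<open>Y \<ge> (N - k) / 2\<close> gives the estimate with constant \<open>1\<close>. The
  hypothesis \<open>k \<le> (2 - C) N / C\<close> says that the threshold lies above the mean, and \<open>k \<le> 3 N / 4\<close>
  turns the factor \<open>2 N / (N - k)\<close> of the Chernoff bound into \<open>8\<close>.
\<close>

section \<open>Maximizers and arm counts\<close>

lemma arg_max_on_finite:
  fixes f :: "'a \<Rightarrow> 'b :: linorder"
  assumes "finite S" "S \<noteq> {}"
  shows "arg_max_on f S \<in> S" and "\<And>y. y \<in> S \<Longrightarrow> f y \<le> f (arg_max_on f S)"
proof -
  have "Max (f ` S) \<in> f ` S"
    using assms by (intro Max_in) auto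
  then obtain x where x: "x \<in> S" "f x = Max (f ` S)"
    by (metis imageE)
  have "arg_max_on f S \<in> S \<and> (\<forall>y\<in>S. f y \<le> f (arg_max_on f S))"
    unfolding arg_max_on_def
    by (rule arg_maxI[of "\<lambda>x. x \<in> S" x f]) (use x assms in \<open>auto simp: not_less dest: leI\<close>)
  then show "arg_max_on f S \<in> S" and "\<And>y. y \<in> S \<Longrightarrow> f y \<le> f (arg_max_on f S)"
    by auto
qed

lemma arm_counts_sample_points:
  assumes "finite I"
  shows "arm_counts (sample_points \<omega> I) b = card {i \<in> I. fst (\<omega> i) = b}"
  using assms
  by (simp add: arm_counts_def sample_points_def filter_mset_image_mset size_mset_set)

lemma arm_counts_diff:
  assumes "U \<subseteq># D"
  shows "arm_counts (D - U) = (\<lambda>b. arm_counts D b - arm_counts U b)"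
proof
  fix b
  have "{#p \<in># U. fst p = b#} \<subseteq># {#p \<in># D. fst p = b#}"
    using assms by (rule multiset_filter_mono)
  then show "arm_counts (D - U) b = arm_counts D b - arm_counts U b"
    by (simp add: arm_counts_def size_Diff_submset)
qed

section \<open>Admissibility of the count-based pair\<close>

text \<open>The case split on the empty request disappears: subtracting the counts of
  \<open>{#}\<close> changes nothing, and the learned arm maximizes that same function.\<close>

lemma count_unlearn_output:
  "unlearn_output (count_unlearner m) (imitation_learner m) arm_counts U D =
    return_pmf (arg_max_on (\<lambda>b. arm_counts D b - arm_counts U b) {1..m})"
  by (simp add: unlearn_output_def count_unlearner_def imitation_learner_def bind_return_pmf
      arm_counts_def[of "{#}"])

text \<open>Unlearning is exact: both outputs are the choice of \<open>arg_max_on\<close> for one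
  and the same function, so even ties are broken alike, and \<open>exp \<epsilon>\<close> is at
  least 1.\<close>

lemma is_unlearning_count_unlearner:
  assumes "\<epsilon> \<ge> 0"
  shows "is_unlearning m \<epsilon> 0 (count_unlearner m) (imitation_learner m) arm_counts"
proof -
  have "p \<le> exp \<epsilon> * p" if "p \<ge> 0" for p :: real
    using mult_right_mono[of 1 "exp \<epsilon>" p] assms that by simp
  then show ?thesis
    by (auto simp: is_unlearning_def count_unlearn_output arm_counts_diff arm_counts_def[of "{#}"])
qed

text \<open>Measurability holds because the output depends on the sample only through the sequence
  of pulled arms, which ranges over a discrete space.\<close>

lemma arm_algorithm_count_unlearner:
  assumes "m \<ge> 1"
  shows "arm_algorithm m (count_unlearner m) (imitation_learner m) arm_counts"
  unfolding arm_algorithm_def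
proof (intro conjI allI impI)
  have arg: "arg_max_on f {1..m} \<in> {1..m}" for f :: "nat \<Rightarrow> nat"
    using assms by (intro arg_max_on_finite) auto
  show "set_pmf (imitation_learner m D) \<subseteq> {1..m}" for D
    using arg by (simp add: imitation_learner_def)
  show "set_pmf (count_unlearner m U a t) \<subseteq> {1..m}" if "a \<in> {1..m}" for U a t
    using arg that by (simp add: count_unlearner_def)
next
  fix N a :: nat and I :: "nat set"
  assume I: "I \<subseteq> {1..N}"
  define F :: "(nat \<Rightarrow> nat) \<Rightarrow> real" where "F = (\<lambda>as. pmf (return_pmf (arg_max_on
    (\<lambda>b. card {i \<in> {1..N}. as i = b} - card {i \<in> I. as i = b}) {1..m})) a)"
  let ?M = "\<Pi>\<^sub>M i\<in>{1..N}. count_space UNIV \<Otimes>\<^sub>M (borel :: real measure)"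
  have eq: "pmf (unlearn_output (count_unlearner m) (imitation_learner m) arm_counts
      (sample_points \<omega> I) (sample_points \<omega> {1..N})) a = F (\<lambda>i\<in>{1..N}. fst (\<omega> i))"
    for \<omega> :: "nat \<Rightarrow> nat \<times> real"
  proof -
    have "{i \<in> J. (\<lambda>i\<in>{1..N}. fst (\<omega> i)) i = b} = {i \<in> J. fst (\<omega> i) = b}"
      if "J \<subseteq> {1..N}" for J b
      using that by auto
    note restrict = this[OF I] this[OF order.refl]
    show ?thesis
      unfolding F_def count_unlearn_output restrict
        arm_counts_sample_points[OF finite_subset[OF I finite_atLeastAtMost]]
        arm_counts_sample_points[OF finite_atLeastAtMost] ..
  qed
  \<comment> \<open>A finite product of countable discrete spaces is discrete, so every function of
    the arm sequence, in particular \<open>F\<close>, is measurable.\<close>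
  have "(\<lambda>\<omega>. \<lambda>i\<in>{1..N}. fst (\<omega> i)) \<in> ?M \<rightarrow>\<^sub>M (\<Pi>\<^sub>M i\<in>{1..N}. count_space UNIV)"
    by measurable
  also have "(\<Pi>\<^sub>M i\<in>{1..N}. count_space (UNIV :: nat set)) =
      count_space (PiE {1..N} (\<lambda>_. UNIV))"
    by (intro count_space_PiM_finite) auto
  finally have *: "(\<lambda>\<omega>. \<lambda>i\<in>{1..N}. fst (\<omega> i)) \<in>
      ?M \<rightarrow>\<^sub>M count_space (PiE {1..N} (\<lambda>_. UNIV :: nat set))" .
  have "F \<in> borel_measurable (count_space (PiE {1..N} (\<lambda>_. UNIV)))"
    by simp
  from measurable_compose[OF * this]
  show "(\<lambda>\<omega>. pmf (unlearn_output (count_unlearner m) (imitation_learner m) arm_counts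
      (sample_points \<omega> I) (sample_points \<omega> {1..N})) a) \<in> borel_measurable ?M"
    unfolding eq .
qed

section \<open>Mean rewards, the law of a data point and its product\<close>

lemma arm_mean_bounds:
  assumes "prob_space (R b)" "AE r in R b. r \<in> {0..1}"
  shows "0 \<le> arm_mean R b" "arm_mean R b \<le> 1"
proof -
  interpret prob_space "R b" by fact
  show "0 \<le> arm_mean R b"
    unfolding arm_mean_def by (rule integral_nonneg_AE) (use assms(2) in eventually_elim, simp)
  have "arm_mean R b \<le> (\<integral>r. 1 \<partial>R b)"
    unfolding arm_mean_def
  proof (rule integral_mono_AE')
    show "AE r in R b. r \<le> 1"
      using assms(2) by eventually_elim simp
  qed simp_all
  then show "arm_mean R b \<le> 1"
    by (simp add: prob_space)
qed

text \<open>Drawing the reward leaves the arm fixed: under \<open>?K b\<close> the event has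
  probability 0 or 1, so the arm marginal is \<open>d\<close>.\<close>

lemma
  fixes d :: "nat pmf" and R :: "nat \<Rightarrow> real measure"
  assumes "\<And>b. prob_space (R b)" "\<And>b. sets (R b) = sets borel"
  shows prob_space_point_dist: "prob_space (point_dist d R)"
    and sets_point_dist: "sets (point_dist d R) = sets (count_space UNIV \<Otimes>\<^sub>M borel)"
    and measure_point_dist_arm: "measure (point_dist d R) {p. fst p = a} = pmf d a"
proof -
  let ?B = "count_space UNIV \<Otimes>\<^sub>M borel :: (nat \<times> real) measure"
  let ?K = "\<lambda>a. distr (R a) ?B (Pair a)"
  have meas: "Pair b \<in> R b \<rightarrow>\<^sub>M ?B" for b
    unfolding measurable_cong_sets[OF assms(2) refl] by measurable
  have prob: "prob_space (?K b)" for b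
    using assms(1) meas by (rule prob_space.prob_space_distr)
  have K: "?K \<in> measure_pmf d \<rightarrow>\<^sub>M subprob_algebra ?B"
    using prob by (auto simp: space_subprob_algebra intro: prob_space_imp_subprob_space)
  show P: "prob_space (point_dist d R)"
    unfolding point_dist_def
    by (rule prob_space.prob_space_bind[OF prob_space_measure_pmf _ K]) (use prob in simp)
  show "sets (point_dist d R) = sets ?B"
    unfolding point_dist_def by (rule sets_bind) auto
  have set: "{p. fst p = a} \<in> sets ?B"
  proof -
    have "{p. fst p = a} = {a} \<times> (UNIV :: real set)" by auto
    then show ?thesis by simp
  qed
  have "emeasure (?K b) {p. fst p = a} = indicator {a} b" for b
  proof -
    have "emeasure (?K b) {p. fst p = a} = emeasure (R b) {r \<in> space (R b). b = a}"
      using emeasure_distr[OF meas set, of b] by (simp add: vimage_def Int_def conj_commute)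
    then show ?thesis
      by (cases "b = a") (simp_all add: prob_space.emeasure_space_1[OF assms(1)])
  qed
  then have "emeasure (point_dist d R) {p. fst p = a} = (\<integral>\<^sup>+b. indicator {a} b \<partial>measure_pmf d)"
    unfolding point_dist_def by (subst emeasure_bind[OF _ K set]) simp_all
  also have "\<dots> = pmf d a"
    by (simp add: emeasure_pmf_single)
  finally show "measure (point_dist d R) {p. fst p = a} = pmf d a"
    by (simp add: measure_def)
qed

text \<open>This is the binomial generating function at \<open>s\<close>. The power is a product of
  one-point factors, which are independent under the product measure.\<close>

lemma
  fixes d :: "nat pmf" and R :: "nat \<Rightarrow> real measure" and s :: real and I :: "nat set"
  assumes "\<And>b. prob_space (R b)" "\<And>b. sets (R b) = sets borel" "finite I"
  defines "M \<equiv> \<Pi>\<^sub>M i\<in>I. point_dist d R"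
  shows integrable_power_card_other_arms:
      "integrable M (\<lambda>\<omega>. s ^ card {i \<in> I. fst (\<omega> i) \<noteq> a})"
    and integral_power_card_other_arms:
      "(\<integral>\<omega>. s ^ card {i \<in> I. fst (\<omega> i) \<noteq> a} \<partial>M) = (pmf d a + (1 - pmf d a) * s) ^ card I"
proof -
  interpret P: prob_space "point_dist d R"
    using assms(1,2) by (rule prob_space_point_dist)
  interpret product_sigma_finite "\<lambda>_ :: nat. point_dist d R"
    by (rule product_sigma_finite.intro) (rule P.sigma_finite_measure_axioms)
  note sets = sets_point_dist[of R d, OF assms(1,2)]
  have space: "space (point_dist d R) = UNIV"
    using sets_eq_imp_space_eq[OF sets] by (simp add: space_pair_measure)
  \<comment> \<open>The factor is 1 on arm \<open>a\<close> and \<open>s\<close> elsewhere, written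
    through the indicator of the event whose probability is known.\<close>
  define h where "h = (\<lambda>p :: nat \<times> real. s - (s - 1) * indicator {p. fst p = a} p)"
  have set: "{p. fst p = a} \<in> sets (point_dist d R)"
  proof -
    have "{p. fst p = a} = {a} \<times> (UNIV :: real set)" by auto
    then show ?thesis using sets by simp
  qed
  have h: "integrable (point_dist d R) h"
    unfolding h_def using set
    by (intro Bochner_Integration.integrable_diff integrable_mult_right integrable_real_indicator)
       (auto simp: P.emeasure_eq_measure)
  have int_h: "integral\<^sup>L (point_dist d R) h = pmf d a + (1 - pmf d a) * s"
  proof -
    have "integral\<^sup>L (point_dist d R) h = s - (s - 1) * measure (point_dist d R) {p. fst p = a}"
      unfolding h_def using set
      by (subst Bochner_Integration.integral_diff)
         (auto simp: P.emeasure_eq_measure space P.prob_space[unfolded space] intro!: integrable_mult_right integrable_real_indicator)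
    then show ?thesis
      by (simp add: measure_point_dist_arm[OF assms(1,2)] algebra_simps)
  qed
  have eq: "s ^ card {i \<in> I. fst (\<omega> i) \<noteq> a} = (\<Prod>i\<in>I. h (\<omega> i))" for \<omega> :: "nat \<Rightarrow> nat \<times> real"
  proof -
    have "(\<Prod>i\<in>I. h (\<omega> i)) = (\<Prod>i\<in>I. if fst (\<omega> i) \<noteq> a then s else 1)"
      by (rule prod.cong) (auto simp: h_def)
    also have "\<dots> = s ^ card {i \<in> I. fst (\<omega> i) \<noteq> a}"
      using \<open>finite I\<close> by (simp add: prod.If_cases Int_def)
    finally show ?thesis by simp
  qed
  show "integrable M (\<lambda>\<omega>. s ^ card {i \<in> I. fst (\<omega> i) \<noteq> a})"
    unfolding eq M_def by (rule product_integrable_prod[OF \<open>finite I\<close> h])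
  show "(\<integral>\<omega>. s ^ card {i \<in> I. fst (\<omega> i) \<noteq> a} \<partial>M) = (pmf d a + (1 - pmf d a) * s) ^ card I"
    unfolding eq M_def using product_integral_prod[OF \<open>finite I\<close> h] by (simp add: int_h)
qed

section \<open>The margin of the best arm and the exponential bound\<close>

lemma request_rule_bounds:
  assumes "request_rule m N k req"
  shows "req as \<subseteq> {1..N}" "card (req as) \<le> k"
proof -
  obtain a0 where "if k \<le> card {i \<in> {1..N}. as i = a0}
      then req as \<subseteq> {i \<in> {1..N}. as i = a0} \<and> card (req as) = k
      else req as = {}"
    using assms unfolding request_rule_def by blast
  then show "req as \<subseteq> {1..N}" "card (req as) \<le> k"
    by (auto split: if_splits)
qed

text \<open>The strict inequality in \<open>few\<close> excludes ties, so the choice made by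
  \<open>arg_max_on\<close> does not matter.\<close>

lemma count_unlearner_best_arm:
  fixes \<omega> :: "nat \<Rightarrow> nat \<times> real"
  assumes a: "a \<in> {1..m}" and J: "J \<subseteq> {1..N}" "card J \<le> k"
    and few: "2 * card {i \<in> {1..N}. fst (\<omega> i) \<noteq> a} + k < N"
  shows "arg_max_on (\<lambda>b. arm_counts (sample_points \<omega> {1..N}) b -
    arm_counts (sample_points \<omega> J) b) {1..m} = a"
proof -
  define Y where "Y = card {i \<in> {1..N}. fst (\<omega> i) \<noteq> a}"
  define f where "f = (\<lambda>b. arm_counts (sample_points \<omega> {1..N}) b -
    arm_counts (sample_points \<omega> J) b)"
  have fin: "finite J" using J(1) finite_subset by blast
  have "card ({i \<in> {1..N}. fst (\<omega> i) = a} \<union> {i \<in> {1..N}. fst (\<omega> i) \<noteq> a}) =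
      card {i \<in> {1..N}. fst (\<omega> i) = a} + Y"
    unfolding Y_def by (rule card_Un_disjoint) auto
  also have "{i \<in> {1..N}. fst (\<omega> i) = a} \<union> {i \<in> {1..N}. fst (\<omega> i) \<noteq> a} = {1..N}"
    by auto
  finally have N: "N = card {i \<in> {1..N}. fst (\<omega> i) = a} + Y"
    by simp
  have "card {i \<in> J. fst (\<omega> i) = a} \<le> card J"
    using fin by (intro card_mono) auto
  \<comment> \<open>\<open>f\<close> uses truncated subtraction on the naturals, hence the additive
    form of this lower bound.\<close>
  with N J(2) have fa: "N \<le> f a + Y + k"
    unfolding f_def arm_counts_sample_points[OF fin]
      arm_counts_sample_points[OF finite_atLeastAtMost] by linarith
  have fb: "f b \<le> Y" if "b \<noteq> a" for b
  proof -
    have "card {i \<in> {1..N}. fst (\<omega> i) = b} \<le> Y"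
      unfolding Y_def using that by (intro card_mono) auto
    then show ?thesis
      by (simp add: f_def arm_counts_sample_points)
  qed
  have "f a \<le> f (arg_max_on f {1..m})"
    using a by (intro arg_max_on_finite) auto
  with fa fb[of "arg_max_on f {1..m}"] few have "arg_max_on f {1..m} = a"
    unfolding Y_def[symmetric] by (cases "arg_max_on f {1..m} = a") linarith+
  then show ?thesis by (simp add: f_def)
qed

text \<open>The loss is at most 1 and vanishes unless \<open>Y\<close> reaches the threshold
  \<open>t\<close>, so it is dominated pointwise by \<open>s\<close> to the power
  \<open>Y - t\<close>, whose integral is explicit.\<close>

lemma expected_subopt_count_unlearner_le:
  fixes s :: real
  assumes inst: "bandit_instance m C d R a" and req: "request_rule m N k req"
    and s: "s \<ge> 1" and C: "C > 1"
  shows "expected_subopt N (count_unlearner m) (imitation_learner m) arm_counts d R a req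
    \<le> s powr (- ((real N - real k) / 2)) * (1 / C + (1 - 1 / C) * s) ^ N"
proof -
  define t where "t = (real N - real k) / 2"
  define Y where "Y = (\<lambda>\<omega> :: nat \<Rightarrow> nat \<times> real. card {i \<in> {1..N}. fst (\<omega> i) \<noteq> a})"
  define M where "M = (\<Pi>\<^sub>M i\<in>{1..N}. point_dist d R)"
  define J where "J = (\<lambda>\<omega> :: nat \<Rightarrow> nat \<times> real. req (\<lambda>i\<in>{1..N}. fst (\<omega> i)))"
  define out where "out = (\<lambda>\<omega>. arg_max_on (\<lambda>b. arm_counts (sample_points \<omega> {1..N}) b -
    arm_counts (sample_points \<omega> (J \<omega>)) b) {1..m})"
  have R: "prob_space (R b)" "sets (R b) = sets borel" "AE r in R b. r \<in> {0..1}" for b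
    using inst by (auto simp: bandit_instance_def)
  have a: "a \<in> {1..m}" and d: "1 / C \<le> pmf d a"
    using inst by (auto simp: bandit_instance_def)
  have int: "integrable M (\<lambda>\<omega>. s ^ Y \<omega>)"
    unfolding Y_def M_def by (rule integrable_power_card_other_arms[OF R(1,2)]) simp
  have le: "arm_mean R a - arm_mean R (out \<omega>) \<le> s powr (- t) * s ^ Y \<omega>" for \<omega>
  proof (cases "2 * Y \<omega> + k < N")
    case True
    then have "out \<omega> = a"
      unfolding out_def J_def Y_def
      by (intro count_unlearner_best_arm[OF a request_rule_bounds[OF req]])
    then show ?thesis using s by simp
  next
    case False
    then have "t \<le> real (Y \<omega>)" by (simp add: t_def)
    then have "1 \<le> s powr (real (Y \<omega>) - t)"
      using s by (intro ge_one_powr_ge_zero) auto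
    also have "\<dots> = s powr (- t) * s ^ Y \<omega>"
      using s by (simp add: powr_realpow[symmetric] powr_add[symmetric])
    finally have "1 \<le> s powr (- t) * s ^ Y \<omega>" .
    moreover have "arm_mean R a - arm_mean R (out \<omega>) \<le> 1"
      using arm_mean_bounds[of R a, OF R(1,3)] arm_mean_bounds[of R "out \<omega>", OF R(1,3)] by linarith
    ultimately show ?thesis by linarith
  qed
  have "expected_subopt N (count_unlearner m) (imitation_learner m) arm_counts d R a req =
      (\<integral>\<omega>. arm_mean R a - arm_mean R (out \<omega>) \<partial>M)"
    unfolding expected_subopt_def count_unlearn_output out_def J_def M_def by simp
  also have "\<dots> \<le> (\<integral>\<omega>. s powr (- t) * s ^ Y \<omega> \<partial>M)"
    \<comment> \<open>Only the dominating function must be shown integrable: it is nonnegative, so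
      the default integral 0 would satisfy the bound too.\<close>
    by (rule integral_mono'[OF integrable_mult_right[OF int] le]) (use s in simp)
  also have "\<dots> = s powr (- t) * (pmf d a + (1 - pmf d a) * s) ^ N"
    unfolding Y_def M_def
    using integral_power_card_other_arms[where R = R and I = "{1..N}" and s = s and a = a and d = d,
        OF R(1,2)] by simp
  also have "\<dots> \<le> s powr (- t) * (1 / C + (1 - 1 / C) * s) ^ N"
  proof (intro mult_left_mono power_mono)
    \<comment> \<open>This product is the difference of the two sides below; for
      \<open>s \<ge> 1\<close> the worst case is \<open>pmf d a = 1 / C\<close>.\<close>
    have "0 \<le> (s - 1) * (pmf d a - 1 / C)"
      using s d by simp
    then show "pmf d a + (1 - pmf d a) * s \<le> 1 / C + (1 - 1 / C) * s"
      by (simp add: algebra_simps diff_divide_distrib)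
    show "0 \<le> pmf d a + (1 - pmf d a) * s"
      using s by (simp add: pmf_le_1)
  qed simp
  finally show ?thesis
    unfolding t_def .
qed

section \<open>Optimisation of the bound and the worst case\<close>

text \<open>
  The multiplier \<open>s\<close> minimises the exponential moment bound: it is the odds ratio of the threshold
  frequency \<open>(N - k) / (2 N)\<close> and the success probability \<open>(C - 1) / C\<close>.
\<close>

lemma chernoff_multiplier:
  fixes n k C :: real
  assumes C: "1 < C" "C < 2" and k: "0 \<le> k" "k \<le> 3 * n / 4" "k \<le> (2 - C) * n / C" and n: "n > 0"
  defines "s \<equiv> (n - k) / ((C - 1) * (n + k))"
  shows "s \<ge> 1"
    and "s powr (- ((n - k) / 2)) * (1 / C + (1 - 1 / C) * s) powr n
      \<le> exp (- ((n - k) / 2) * ln (C / (8 * (C - 1))) + (n + k) / 2 * ln (2 / C))"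
proof -
  have nk: "n - k > 0" "n + k > 0" using k n by linarith+
  have "k * C \<le> (2 - C) * n" using k(3) C by (simp add: field_simps)
  \<comment> \<open>The second bound on \<open>k\<close> is equivalent to this inequality, that is,
    to \<open>s \<ge> 1\<close>.\<close>
  then have "(C - 1) * (n + k) \<le> n - k" by (simp add: algebra_simps)
  then show s1: "s \<ge> 1"
    using nk C by (simp add: s_def)
  define q where "q = 2 * n / (C * (n + k))"
  have q: "q > 0" using n nk C by (simp add: q_def)
  have sq: "1 / C + (1 - 1 / C) * s = q"
  proof -
    have "(1 - 1 / C) * s = (n - k) / (C * (n + k))"
    proof -
      have "1 - 1 / C = (C - 1) / C" using C by (simp add: field_simps)
      then show ?thesis using C by (simp add: s_def)
    qed
    moreover have "1 / C = (n + k) / (C * (n + k))"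
      using C nk by simp
    ultimately have "1 / C + (1 - 1 / C) * s = ((n + k) + (n - k)) / (C * (n + k))"
      by (simp only: add_divide_distrib)
    then show ?thesis by (simp add: q_def)
  qed
  have "s powr (- ((n - k) / 2)) * q powr n = exp (- ((n - k) / 2) * ln s + n * ln q)"
    using s1 q unfolding powr_def exp_add by simp
  \<comment> \<open>Splitting \<open>n\<close> into \<open>(n - k) / 2\<close> and
    \<open>(n + k) / 2\<close> lets \<open>q / s\<close> and \<open>q\<close> be estimated
    separately, one for each term of the target exponent.\<close>
  also have "- ((n - k) / 2) * ln s + n * ln q = (n - k) / 2 * ln (q / s) + (n + k) / 2 * ln q"
    using s1 q by (simp add: ln_div algebra_simps add_divide_distrib diff_divide_distrib)
  also have "exp \<dots> \<le> exp ((n - k) / 2 * ln (8 * (C - 1) / C) + (n + k) / 2 * ln (2 / C))"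
  proof (subst exp_le_cancel_iff, intro add_mono mult_left_mono)
    have "q / s = 2 * n / (n - k) * ((C - 1) / C)"
    proof -
      have "2 * n / (C * w) / (u / (D * w)) = 2 * n / u * (D / C)"
        if "u > 0" "w > 0" "D > 0" for u w D
        using that C by (simp add: field_simps)
      from this[of "n - k" "n + k" "C - 1"] show ?thesis
        using C nk by (simp add: q_def s_def)
    qed
    also have "\<dots> \<le> 8 * ((C - 1) / C)"
      using C nk k by (intro mult_right_mono) (auto simp: field_simps)
    finally have "q / s \<le> 8 * (C - 1) / C" by simp
    moreover have "q / s > 0" using q s1 by simp
    ultimately show "ln (q / s) \<le> ln (8 * (C - 1) / C)" by simp
    have "q = 2 / C * (n / (n + k))"
      by (simp add: q_def)
    also have "\<dots> \<le> 2 / C * 1"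
      using C nk k by (intro mult_left_mono) auto
    finally have "q \<le> 2 / C" by simp
    then show "ln q \<le> ln (2 / C)" using q by (rule ln_mono)
  qed (use nk in auto)
  also have "(n - k) / 2 * ln (8 * (C - 1) / C) = - ((n - k) / 2) * ln (C / (8 * (C - 1)))"
  proof -
    have "ln (8 * (C - 1) / C) = - ln (C / (8 * (C - 1)))"
      using C by (subst ln_inverse[symmetric]) (auto simp: field_simps)
    then show ?thesis by simp
  qed
  finally show "s powr (- ((n - k) / 2)) * (1 / C + (1 - 1 / C) * s) powr n
      \<le> exp (- ((n - k) / 2) * ln (C / (8 * (C - 1))) + (n + k) / 2 * ln (2 / C))"
    unfolding sq .
qed

text \<open>The bound for one instance and one request involves only \<open>N\<close>,
  \<open>k\<close> and \<open>C\<close>, so it passes to the supremum.\<close>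

lemma worst_subopt_count_unlearner_le:
  assumes C: "1 < C" "C < 2"
    and k: "real k \<le> 3 * real N / 4" "real k \<le> (2 - C) * real N / C"
  shows "worst_subopt m N C k (count_unlearner m) (imitation_learner m) arm_counts
    \<le> ereal (exp (- ((real N - real k) / 2) * ln (C / (8 * (C - 1)))
        + (real N + real k) / 2 * ln (2 / C)))"
  unfolding worst_subopt_def
proof (intro SUP_least, clarify, unfold ereal_less_eq)
  fix d R a req
  assume inst: "bandit_instance m C d R a" and req: "request_rule m N k req"
  note le = expected_subopt_count_unlearner_le[OF inst req _ C(1)]
  show "expected_subopt N (count_unlearner m) (imitation_learner m) arm_counts d R a req
    \<le> exp (- ((real N - real k) / 2) * ln (C / (8 * (C - 1)))
        + (real N + real k) / 2 * ln (2 / C))"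
  proof (cases "N = 0")
    \<comment> \<open>Here \<open>k = 0\<close> as well and the multiplier degenerates to a division
      by zero; \<open>s = 1\<close> serves instead, and both sides equal 1.\<close>
    case True
    then show ?thesis using le[of 1] k by simp
  next
    case False
    then have N: "real N > 0" by simp
    let ?s = "(real N - real k) / ((C - 1) * (real N + real k))"
    have s: "?s \<ge> 1"
      by (rule chernoff_multiplier[OF C _ k N]) simp
    \<comment> \<open>Positivity allows passing between the real power \<open>powr\<close> and the
      natural power.\<close>
    have "1 / C + (1 - 1 / C) * ?s > 0"
      using s C by (intro add_pos_nonneg mult_nonneg_nonneg) auto
    then show ?thesis
      using le[OF s] chernoff_multiplier(2)[OF C _ k N] by (simp add: powr_realpow)
  qed
qed

theorem theorem3p11:
  shows "\<exists>c>0. \<forall>(m::nat) (N::nat) (k::nat) (C::real) (\<epsilon>::real).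
    m \<ge> 1 \<longrightarrow> 1 < C \<longrightarrow> C < 2 \<longrightarrow> \<epsilon> \<ge> 0 \<longrightarrow>
    real k \<le> min (3 * real N / 4) ((2 - C) * real N / C) \<longrightarrow>
    (let bound = c * exp (- ((real N - real k) / 2) * ln (C / (8 * (C - 1)))
                          + (real N + real k) / 2 * ln (2 / C))
     in worst_subopt m N C k (count_unlearner m) (imitation_learner m) arm_counts \<le> ereal bound \<and>
        SubOpt m N C k \<epsilon> 0 \<le> ereal bound)"
proof (intro exI[of _ 1] conjI allI impI)
  fix m N k :: nat and C \<epsilon> :: real
  assume m: "m \<ge> 1" and C: "1 < C" "C < 2" and \<epsilon>: "\<epsilon> \<ge> 0"
    and k: "real k \<le> min (3 * real N / 4) ((2 - C) * real N / C)"
  have "SubOpt m N C k \<epsilon> 0 \<le>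
      worst_subopt m N C k (count_unlearner m) (imitation_learner m) arm_counts"
    unfolding SubOpt_def
    \<comment> \<open>The count-based pair is one candidate in the infimum defining
      \<open>SubOpt\<close>.\<close>
    by (rule INF_lower2[of "(count_unlearner m, imitation_learner m, arm_counts)"])
       (simp_all add: arm_algorithm_count_unlearner[OF m] is_unlearning_count_unlearner[OF \<epsilon>])
  moreover note worst_subopt_count_unlearner_le[OF C, of k N m]
  ultimately show "let bound = 1 * exp (- ((real N - real k) / 2) * ln (C / (8 * (C - 1)))
                          + (real N + real k) / 2 * ln (2 / C))
     in worst_subopt m N C k (count_unlearner m) (imitation_learner m) arm_counts \<le> ereal bound \<and>
        SubOpt m N C k \<epsilon> 0 \<le> ereal bound"
    using k by (simp add: Let_def)
qed simp

end
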